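(* Let $T\colon X\to X$ be a homeomorphism of a compact metric space $X$. Let $f,g\colon X\to(0,1]$ and $\phi\colon X\to\mathbb{R}$ be continuous, and suppose that $\beta(\log f)=\beta(\log g)=0$. For $x\in X$ define \[A(x):=\begin{pmatrix}f(x)&\phi(x)\\0&g(x)\end{pmatrix}\in\mathrm{GL}_2(\mathbb{R}).\] If $\mathcal{M}_{\max}(\log f)\cap\mathcal{M}_{\max}(\log g)\neq\emptyset$ then \[\lim_{n\to\infty}\frac1n\sup_{x\in X}\|A(T^{n-1}x)\cdots A(x)\|=\sup_{\mu\in\mathcal{M}_{\max}(\log f)\cap\mathcal{M}_{\max}(\log g)}\left|\int\phi\,d\mu\right|,\] and if $\mathcal{M}_{\max}(\log f)\cap\mathcal{M}_{\max}(\log g)=\emptyset$ then \[\lim_{n\to\infty}\frac1n\sup_{x\in X}\|A(T^{n-1}x)\cdots A(x)\|=0.\] (In particular these limits exist.)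
   Context: $\|\cdot\|$ is the Euclidean operator norm. $\mathcal{M}_T(X)$ denotes the set of $T$-invariant Borel probability measures on $X$. For continuous $\psi\colon X\to\mathbb{R}$, $\beta(\psi):=\sup_{\mu\in\mathcal{M}_T(X)}\int\psi\,d\mu$, and $\mathcal{M}_{\max}(\psi):=\{\mu\in\mathcal{M}_T(X)\colon\int\psi\,d\mu=\beta(\psi)\}$. *)

theory Defs
  imports "HOL-Analysis.Analysis" "HOL-Probability.Probability"
begin

definition invariant_measures :: "'a::metric_space set \<Rightarrow> ('a \<Rightarrow> 'a) \<Rightarrow> 'a measure set" where
  "invariant_measures X T = {\<mu>. prob_space \<mu> \<and> sets \<mu> = sets (restrict_space borel X) \<and>
      T \<in> measurable \<mu> \<mu> \<and>
      (\<forall>B\<in>sets \<mu>. emeasure \<mu> (T -` B \<inter> space \<mu>) = emeasure \<mu> B)}"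

definition beta :: "'a::metric_space set \<Rightarrow> ('a \<Rightarrow> 'a) \<Rightarrow> ('a \<Rightarrow> real) \<Rightarrow> real" where
  "beta X T \<psi> = (SUP \<mu>\<in>invariant_measures X T. integral\<^sup>L \<mu> \<psi>)"

definition max_measures :: "'a::metric_space set \<Rightarrow> ('a \<Rightarrow> 'a) \<Rightarrow> ('a \<Rightarrow> real) \<Rightarrow> 'a measure set" where
  "max_measures X T \<psi> = {\<mu>\<in>invariant_measures X T. integral\<^sup>L \<mu> \<psi> = beta X T \<psi>}"

definition uptri :: "real \<Rightarrow> real \<Rightarrow> real \<Rightarrow> real^2^2" where
  "uptri a c b = (\<chi> i j. if i = 1 \<and> j = 1 then a else if i = 1 \<and> j = 2 then c
                          else if i = 2 \<and> j = 2 then b else 0)"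

fun cocycle :: "('a \<Rightarrow> real^2^2) \<Rightarrow> ('a \<Rightarrow> 'a) \<Rightarrow> nat \<Rightarrow> 'a \<Rightarrow> real^2^2" where
  "cocycle A T 0 x = mat 1"
| "cocycle A T (Suc n) x = A ((T ^^ n) x) ** cocycle A T n x"

definition mnorm :: "real^2^2 \<Rightarrow> real" where
  "mnorm M = onorm (\<lambda>v. M *v v)"

end

theory Submission
  imports Defs
begin

text \<open>
  The upper right corner of the \<open>n\<close>-fold product at \<open>x\<close> is \<open>\<Sum>k<n. w k * \<phi> (T^k x)\<close>, where \<open>w k\<close> is
  the product of the \<open>g (T^i x)\<close> over \<open>i < k\<close> and of the \<open>f (T^i x)\<close> over \<open>k < i < n\<close>; the diagonal is
  bounded by 1, so only the corner matters. If \<open>\<mu>\<close> is maximising for both \<open>ln f\<close> and \<open>ln g\<close>, then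
  \<open>f = g = 1\<close> along almost every orbit, the corner is the Birkhoff sum of \<open>\<phi>\<close>, and integrating it
  gives the lower bound.

  For the upper bound, suppose the corner is at least \<open>n c\<close> in modulus for infinitely many \<open>n\<close>, with
  \<open>c > 0\<close>. The weights have total variation at most 2, being products of a monotone and an antitone
  function with values in \<open>[0, 1]\<close>, and their total mass is at least of order \<open>n\<close>; hence every weak limit
  of the normalised measures \<open>\<Sum>k<n. w k \<delta>(T^k x)\<close> is invariant. Telescoping gives
  \<open>\<Sum>k<n. w k (1 - f (T^k x)) \<le> 1\<close> and likewise for \<open>g\<close>, so the limit lives on \<open>f = g = 1\<close> and is
  maximising for both. Since the mass before normalisation is at most \<open>n\<close>, the limit satisfies
  \<open>\<bar>\<integral>\<phi> d\<mu>\<bar> \<ge> c\<close>.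
\<close>

section \<open>Compact metric spaces as continuous images of compact sets of reals\<close>

text \<open>The first nonzero digit contributes \<open>(1/3)^i\<close> and the later ones at most
  \<open>(1/3)^i / 2\<close> in total, so they cannot cancel it. Base 2 would allow exact
  cancellation.\<close>

lemma ternary_expansion_gap:
  fixes d :: "nat \<Rightarrow> real"
  assumes "\<And>j. \<bar>d j\<bar> \<le> 1" and "\<And>j. j < i \<Longrightarrow> d j = 0" and "\<bar>d i\<bar> = 1"
  shows "(1/3)^i / 2 \<le> \<bar>\<Sum>j. d j * (1/3)^j\<bar>"
proof -
  have bound: "norm (d j * (1/3)^j) \<le> (1/3)^j" for j
    using assms(1)[of j] by (simp add: abs_mult mult_left_le_one_le)
  have geo: "summable (\<lambda>j. (1/3::real)^j)" by (rule summable_geometric) simp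
  have summ: "summable (\<lambda>j. d j * (1/3)^j)"
    by (rule summable_comparison_test'[OF geo bound])
  have geo': "(\<lambda>j. (1/3::real)^(j + Suc i)) sums ((1/3)^i/2)"
    using sums_mult2[OF geometric_sums[of "1/3::real"], of "(1/3)^Suc i"]
    by (simp add: power_add field_simps)
  have tail: "\<bar>\<Sum>j. d (j + Suc i) * (1/3)^(j + Suc i)\<bar> \<le> (1/3)^i/2"
    using norm_suminf_le[of "\<lambda>j. d (j + Suc i) * (1/3)^(j + Suc i)", OF bound sums_summable[OF geo']]
      sums_unique[OF geo'] by simp
  have "(\<Sum>j. d j * (1/3)^j) = (\<Sum>j. d (j + Suc i) * (1/3)^(j + Suc i)) + (\<Sum>j<Suc i. d j * (1/3)^j)"
    by (rule suminf_split_initial_segment[OF summ])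
  also have "(\<Sum>j<Suc i. d j * (1/3)^j) = d i * (1/3)^i"
    using assms(2) by simp
  finally have *: "(\<Sum>j. d j * (1/3)^j) = (\<Sum>j. d (j + Suc i) * (1/3)^(j + Suc i)) + d i * (1/3)^i" .
  have "\<bar>d i * (1/3)^i\<bar> = (1/3)^i" using assms(3) by (simp add: abs_mult)
  then show ?thesis unfolding * using tail
    abs_triangle_ineq2[of "d i * (1/3)^i" "- (\<Sum>j. d (j + Suc i) * (1/3)^(j + Suc i))"]
    by (simp add: add.commute del: power_Suc add_Suc_right)
qed

text \<open>The gap estimate, applied to the digit differences at the first index where the digits
  disagree: a disagreement no later than \<open>m\<close> already separates the sums by
  \<open>(1/3)^m / 2\<close>.\<close>

lemma ternary_expansion_eq:
  fixes b c :: "nat \<Rightarrow> bool"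
  assumes "\<bar>(\<Sum>j. of_bool (b j) * (1/3)^j) - (\<Sum>j. of_bool (c j) * (1/3)^j)\<bar> < (1/3::real)^m / 2"
    and "i \<le> m"
  shows "b i = c i"
proof (rule ccontr)
  assume "b i \<noteq> c i"
  define k where "k = (LEAST k. b k \<noteq> c k)"
  have k: "b k \<noteq> c k" unfolding k_def by (rule LeastI) fact
  have lt: "b j = c j" if "j < k" for j
    using not_less_Least[of j "\<lambda>k. b k \<noteq> c k"] that by (auto simp: k_def)
  have "k \<le> m" using Least_le[of "\<lambda>k. b k \<noteq> c k" i] \<open>b i \<noteq> c i\<close> assms(2) by (simp add: k_def)
  have summ: "summable (\<lambda>j. of_bool (b j) * (1/3::real)^j)" for b
    by (rule summable_comparison_test'[OF summable_geometric[of "1/3"]]) auto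
  have "(1/3)^k / 2 \<le> \<bar>\<Sum>j. (of_bool (b j) - of_bool (c j)) * (1/3::real)^j\<bar>"
    by (rule ternary_expansion_gap) (use k lt in \<open>auto simp: of_bool_def\<close>)
  also have "\<dots> = \<bar>(\<Sum>j. of_bool (b j) * (1/3)^j) - (\<Sum>j. of_bool (c j) * (1/3::real)^j)\<bar>"
    by (simp add: suminf_diff[OF summ summ] left_diff_distrib)
  also have "\<dots> < (1/3)^m / 2" by (rule assms)
  finally show False using power_decreasing[OF \<open>k \<le> m\<close>, of "1/3::real"] by simp
qed

text \<open>By total boundedness there is a finite net at each scale
  \<open>1 / real (Suc k)\<close>; all the balls are listed in one sequence. A given
  \<open>e\<close> needs the finitely many balls of one scale only, whence a bound \<open>m\<close>
  on the indices that serves all of \<open>X\<close>.\<close>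

lemma compact_countable_fine_cover:
  fixes X :: "'a::metric_space set"
  assumes "compact X"
  obtains B :: "nat \<Rightarrow> 'a set" where
    "\<And>e. 0 < e \<Longrightarrow> \<exists>m. \<forall>x\<in>X. \<exists>i\<le>m. x \<in> B i \<and> (\<forall>y\<in>B i. dist x y < e)"
proof -
  have "\<exists>C. finite C \<and> C \<subseteq> X \<and> X \<subseteq> (\<Union>c\<in>C. ball c (1 / real (Suc k)))" for k
    using seq_compact_imp_totally_bounded[OF assms[unfolded compact_eq_seq_compact_metric]] by simp
  then obtain C where C: "\<And>k. finite (C k)" "\<And>k. X \<subseteq> (\<Union>c\<in>C k. ball c (1 / real (Suc k)))"
    by metis
  define BB where "BB = (\<Union>k. (\<lambda>c. ball c (1 / real (Suc k))) ` C k)"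
  have cBB: "countable BB" using C(1) by (auto simp: BB_def intro: countable_finite)
  show ?thesis
  proof (rule that[of "from_nat_into BB"])
    fix e :: real assume "0 < e"
    then obtain k where k: "1 / real (Suc k) < e / 2"
      using nat_approx_posE[of "e/2"] by auto
    define m where "m = Max (to_nat_on BB ` (\<lambda>c. ball c (1 / real (Suc k))) ` C k)"
    show "\<exists>m. \<forall>x\<in>X. \<exists>i\<le>m. x \<in> from_nat_into BB i \<and> (\<forall>y\<in>from_nat_into BB i. dist x y < e)"
    proof (rule exI[of _ m], rule ballI)
      fix x assume "x \<in> X"
      then obtain c where c: "c \<in> C k" "x \<in> ball c (1 / real (Suc k))" using C(2) by blast
      let ?i = "to_nat_on BB (ball c (1 / real (Suc k)))"
      have "?i \<le> m" unfolding m_def by (rule Max_ge) (use C(1) c in auto)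
      moreover have "from_nat_into BB ?i = ball c (1 / real (Suc k))"
        by (rule from_nat_into_to_nat_on[OF cBB]) (use c in \<open>auto simp: BB_def\<close>)
      moreover have "dist x y < e" if "y \<in> ball c (1 / real (Suc k))" for y
        using that c(2) k dist_triangle3[of x y c] by (simp add: dist_commute)
      ultimately show "\<exists>i\<le>m. x \<in> from_nat_into BB i \<and> (\<forall>y\<in>from_nat_into BB i. dist x y < e)"
        using c(2) by auto
    qed
  qed
qed

text \<open>
  The code \<open>\<kappa>\<close> is neither continuous nor measurable; only its inverse is uniformly continuous.
\<close>

lemma compact_real_code:
  fixes X :: "'a::metric_space set"
  assumes "compact X"
  obtains \<kappa> :: "'a \<Rightarrow> real" where "\<kappa> ` X \<subseteq> {0..2}"
    and "\<And>e. 0 < e \<Longrightarrow> \<exists>d>0. \<forall>x\<in>X. \<forall>y\<in>X. \<bar>\<kappa> x - \<kappa> y\<bar> < d \<longrightarrow> dist x y < e"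
proof -
  obtain B :: "nat \<Rightarrow> 'a set" where
    B: "\<And>e. 0 < e \<Longrightarrow> \<exists>m. \<forall>x\<in>X. \<exists>i\<le>m. x \<in> B i \<and> (\<forall>y\<in>B i. dist x y < e)"
    using compact_countable_fine_cover[OF assms] by metis
  \<comment> \<open>The \<open>j\<close>-th ternary digit records whether the point lies in
    \<open>B j\<close>.\<close>
  define \<kappa> where "\<kappa> x = (\<Sum>j. of_bool (x \<in> B j) * (1/3::real)^j)" for x
  have summ: "summable (\<lambda>j. of_bool (x \<in> B j) * (1/3::real)^j)" for x
    by (rule summable_comparison_test'[OF summable_geometric[of "1/3"]]) auto
  show ?thesis
  proof
    have "0 \<le> \<kappa> x" for x unfolding \<kappa>_def by (rule suminf_nonneg[OF summ]) simp
    moreover have "\<kappa> x \<le> 2" for x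
    proof -
      have "\<kappa> x \<le> (\<Sum>j. (1/3::real)^j)" unfolding \<kappa>_def
        by (rule suminf_le[OF _ summ summable_geometric]) auto
      then show ?thesis by (simp add: suminf_geometric)
    qed
    ultimately show "\<kappa> ` X \<subseteq> {0..2}" by auto
  next
    fix e :: real assume "0 < e"
    then obtain m where m: "\<forall>x\<in>X. \<exists>i\<le>m. x \<in> B i \<and> (\<forall>y\<in>B i. dist x y < e)"
      using B by blast
    \<comment> \<open>Codes closer than \<open>(1/3)^m/2\<close> agree in all digits up to
      \<open>m\<close>, in particular in the digit of a small set \<open>B i\<close> containing
      \<open>x\<close>; so \<open>y\<close> lies in it too.\<close>
    show "\<exists>d>0. \<forall>x\<in>X. \<forall>y\<in>X. \<bar>\<kappa> x - \<kappa> y\<bar> < d \<longrightarrow> dist x y < e"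
    proof (intro exI[of _ "(1/3)^m/2"] conjI ballI impI)
      fix x y assume "x \<in> X" "y \<in> X" and less: "\<bar>\<kappa> x - \<kappa> y\<bar> < (1/3)^m/2"
      then obtain i where i: "i \<le> m" "x \<in> B i" "\<forall>y\<in>B i. dist x y < e" using m by blast
      have "(x \<in> B i) = (y \<in> B i)"
        using ternary_expansion_eq[OF less[unfolded \<kappa>_def] i(1)] .
      then show "dist x y < e" using i by blast
    qed simp
  qed
qed

text \<open>The inverse of the code is uniformly continuous on the set of codes, so it extends
  continuously to the closure \<open>K\<close> of that set; the extension stays in \<open>X\<close>
  because \<open>X\<close> is compact.\<close>

theorem compact_metric_continuous_image_of_compact_real:
  fixes X :: "'a::metric_space set"
  assumes "compact X"
  obtains K :: "real set" and \<pi> where "compact K" "continuous_on K \<pi>" "\<pi> ` K = X"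
proof -
  obtain \<kappa> :: "'a \<Rightarrow> real" where bd: "\<kappa> ` X \<subseteq> {0..2}"
    and \<kappa>: "\<And>e. 0 < e \<Longrightarrow> \<exists>d>0. \<forall>x\<in>X. \<forall>y\<in>X. \<bar>\<kappa> x - \<kappa> y\<bar> < d \<longrightarrow> dist x y < e"
    using compact_real_code[OF assms] by metis
  define K where "K = closure (\<kappa> ` X)"
  have "\<exists>l\<in>X. \<exists>s. (\<forall>n. s n \<in> X) \<and> (\<lambda>n. \<kappa> (s n)) \<longlonglongrightarrow> y \<and> s \<longlonglongrightarrow> l" if y: "y \<in> K" for y
  proof -
    obtain t where "\<forall>n. t n \<in> \<kappa> ` X" "t \<longlonglongrightarrow> y"
      using y unfolding K_def closure_sequential by blast
    then obtain s where s: "\<And>n. s n \<in> X" and "\<And>n. t n = \<kappa> (s n)"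
      unfolding image_iff by metis
    then have "t = (\<lambda>n. \<kappa> (s n))" by (intro ext)
    with \<open>t \<longlonglongrightarrow> y\<close> have lim: "(\<lambda>n. \<kappa> (s n)) \<longlonglongrightarrow> y" by blast
    obtain l r where "l \<in> X" "strict_mono r" "(s \<circ> r) \<longlonglongrightarrow> l"
      using assms s unfolding compact_def by metis
    moreover have "((\<lambda>n. \<kappa> (s n)) \<circ> r) \<longlonglongrightarrow> y"
      by (rule LIMSEQ_subseq_LIMSEQ[OF lim]) fact
    ultimately show ?thesis using s by (intro bexI[of _ l] exI[of _ "s \<circ> r"]) (auto simp: o_def)
  qed
  then obtain \<pi> where \<pi>: "\<And>y. y \<in> K \<Longrightarrow> \<pi> y \<in> X"
    "\<And>y. y \<in> K \<Longrightarrow> \<exists>s. (\<forall>n. s n \<in> X) \<and> (\<lambda>n. \<kappa> (s n)) \<longlonglongrightarrow> y \<and> s \<longlonglongrightarrow> \<pi> y"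
    by metis
  \<comment> \<open>This one estimate gives both that \<open>\<pi>\<close> inverts the code, taking
    \<open>y\<close> to be the code of \<open>x\<close>, and that \<open>\<pi>\<close> is
    continuous, comparing two nearby points of \<open>K\<close> through one code close to
    both.\<close>
  have near: "\<exists>d>0. \<forall>x\<in>X. \<forall>y\<in>K. \<bar>\<kappa> x - y\<bar> < d \<longrightarrow> dist x (\<pi> y) \<le> e" if "e > 0" for e
  proof -
    obtain d where d: "d > 0" "\<forall>x\<in>X. \<forall>y\<in>X. \<bar>\<kappa> x - \<kappa> y\<bar> < d \<longrightarrow> dist x y < e"
      using \<kappa> \<open>e > 0\<close> by blast
    have "dist x (\<pi> y) \<le> e" if "x \<in> X" "y \<in> K" "\<bar>\<kappa> x - y\<bar> < d" for x y
    proof -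
      obtain s where s: "\<forall>n. s n \<in> X" "(\<lambda>n. \<kappa> (s n)) \<longlonglongrightarrow> y" "s \<longlonglongrightarrow> \<pi> y"
        using \<pi>(2) \<open>y \<in> K\<close> by blast
      have "(\<lambda>n. \<bar>\<kappa> x - \<kappa> (s n)\<bar>) \<longlonglongrightarrow> \<bar>\<kappa> x - y\<bar>" by (intro tendsto_intros s)
      then have "eventually (\<lambda>n. \<bar>\<kappa> x - \<kappa> (s n)\<bar> < d) sequentially"
        using that(3) by (rule order_tendstoD)
      then have "eventually (\<lambda>n. dist x (s n) \<le> e) sequentially"
        by eventually_elim (use d s that in \<open>auto intro: less_imp_le\<close>)
      then show ?thesis
        by (intro tendsto_upperbound[OF tendsto_dist[OF tendsto_const s(3)]]) auto
    qed
    then show ?thesis using d(1) by blast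
  qed
  have inK: "\<kappa> x \<in> K" if "x \<in> X" for x using that closure_subset[of "\<kappa> ` X"] by (auto simp: K_def)
  show ?thesis
  proof
    show "compact K" unfolding K_def compact_closure
      by (rule bounded_subset[OF bounded_closed_interval bd])
    have "\<pi> (\<kappa> x) = x" if "x \<in> X" for x
    proof -
      have "dist x (\<pi> (\<kappa> x)) \<le> 0 + e" if "e > 0" for e
        using near[OF that] inK \<open>x \<in> X\<close> by force
      then have "dist x (\<pi> (\<kappa> x)) \<le> 0" by (rule field_le_epsilon)
      then show ?thesis by simp
    qed
    then show "\<pi> ` K = X" using \<pi>(1) inK by (force simp: image_iff)
    show "continuous_on K \<pi>" unfolding continuous_on_iff
    proof (intro ballI allI impI)
      fix y e assume y: "y \<in> K" and "0 < (e::real)"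
      then obtain d where d: "d > 0" "\<forall>x\<in>X. \<forall>y\<in>K. \<bar>\<kappa> x - y\<bar> < d \<longrightarrow> dist x (\<pi> y) \<le> e/3"
        using near[of "e/3"] by auto
      obtain x where x: "x \<in> X" "\<bar>\<kappa> x - y\<bar> < d/2"
        using y d(1) unfolding K_def closure_approachable dist_real_def
        by (metis half_gt_zero imageE)
      have "dist (\<pi> y') (\<pi> y) < e" if "y' \<in> K" "dist y' y < d/2" for y'
      proof -
        have "\<bar>\<kappa> x - y'\<bar> < d" using x(2) that(2) unfolding dist_real_def by linarith
        then have "dist x (\<pi> y') \<le> e/3" "dist x (\<pi> y) \<le> e/3"
          using d x that y by auto
        then show ?thesis using \<open>0 < e\<close> dist_triangle3[of "\<pi> y'" "\<pi> y" x] by simp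
      qed
      then show "\<exists>d>0. \<forall>y'\<in>K. dist y' y < d \<longrightarrow> dist (\<pi> y') (\<pi> y) < e"
        using d(1) by (intro exI[of _ "d/2"]) auto
    qed
  qed
qed

section \<open>Weak limits and invariance\<close>

lemma compact_continuous_abs_bound:
  fixes h :: "'a::topological_space \<Rightarrow> real"
  assumes "compact X" and "continuous_on X h"
  obtains B where "B > 0" "\<And>x. x \<in> X \<Longrightarrow> \<bar>h x\<bar> \<le> B"
  using compact_imp_bounded[OF compact_continuous_image[OF assms(2,1)]]
  by (auto simp: bounded_pos)

text \<open>
  Helly's selection theorem is available for distributions on the real line only, so the measures
  are lifted to a compact set of reals through a continuous surjection onto \<open>X\<close>. The lift is an
  arbitrary section of that surjection; discreteness of the measures makes it measurable.
\<close>

theorem pmf_compact_weakly_convergent_subsequence: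
  fixes X :: "'a::metric_space set" and p :: "nat \<Rightarrow> 'a pmf"
  assumes "compact X" and supp: "\<And>n. set_pmf (p n) \<subseteq> X"
  obtains r \<mu> where "strict_mono (r :: nat \<Rightarrow> nat)" "prob_space \<mu>" "sets \<mu> = sets (restrict_space borel X)"
    "\<And>h :: 'a \<Rightarrow> real. continuous_on X h \<Longrightarrow>
       (\<lambda>n. measure_pmf.expectation (p (r n)) h) \<longlonglongrightarrow> integral\<^sup>L \<mu> h"
proof -
  obtain K :: "real set" and \<pi> where K: "compact K" "continuous_on K \<pi>" "\<pi> ` K = X"
    using compact_metric_continuous_image_of_compact_real[OF assms(1)] by metis
  define \<kappa> where "\<kappa> = inv_into K \<pi>"
  have \<kappa>: "\<kappa> x \<in> K" "\<pi> (\<kappa> x) = x" if "x \<in> X" for x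
    using that K(3) by (auto simp: \<kappa>_def inv_into_into f_inv_into_f)
  define N where "N n = distr (measure_pmf (p n)) borel \<kappa>" for n
  have rd: "real_distribution (N n)" for n
    unfolding N_def by (intro prob_space.real_distribution_distr measure_pmf.prob_space_axioms) simp
  have integral_N: "integral\<^sup>L (N n) u = measure_pmf.expectation (p n) (\<lambda>x. u (\<kappa> x))"
    if "u \<in> borel_measurable borel" for u :: "real \<Rightarrow> real" and n
    unfolding N_def by (rule integral_distr) (use that in auto)
  have AE_X: "AE x in measure_pmf (p n). x \<in> X" for n
    using supp by (auto simp: AE_measure_pmf_iff)
  obtain b where b: "b > 0" "\<And>y. y \<in> K \<Longrightarrow> \<bar>y\<bar> \<le> b"
    using compact_imp_bounded[OF K(1)] unfolding bounded_pos real_norm_def by metis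
  \<comment> \<open>The interval is open on the left, hence \<open>-b-1\<close> in place of
    \<open>-b\<close>: it has to contain all of \<open>K\<close>.\<close>
  have "measure (N n) {-b-1<..b} = 1" for n
  proof -
    have "measure (N n) {-b-1<..b} = measure_pmf.prob (p n) (\<kappa> -` {-b-1<..b})"
      unfolding N_def by (subst measure_distr) auto
    also have "\<dots> = 1"
      using supp \<kappa>(1) b(2) by (subst measure_pmf.prob_eq_1) (force simp: AE_measure_pmf_iff abs_le_iff)+
    finally show ?thesis .
  qed
  then have "tight N"
    unfolding tight_def using rd b(1) by (intro conjI allI impI exI[of _ "-b-1"] exI[of _ b]) auto
  from tight_imp_convergent_subsubsequence[OF this strict_mono_id]
  obtain r M where r: "strict_mono r" and M: "real_distribution M" and "weak_conv_m (N \<circ> id \<circ> r) M"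
    by blast
  then have wc: "weak_conv_m (N \<circ> r) M" by simp
  interpret M: real_distribution M by (rule M)
  have conv: "(\<lambda>n. measure_pmf.expectation (p (r n)) (\<lambda>x. u (\<kappa> x))) \<longlonglongrightarrow> integral\<^sup>L M u"
    if "continuous_on UNIV u" "\<And>y. norm (u y) \<le> B" for u :: "real \<Rightarrow> real" and B
  proof -
    have "(\<lambda>n. integral\<^sup>L ((N \<circ> r) n) u) \<longlonglongrightarrow> integral\<^sup>L M u"
      by (rule weak_conv_imp_integral_bdd_continuous_conv[OF _ M wc, of u B])
         (use rd that in \<open>auto simp: continuous_on_eq_continuous_at\<close>)
    then show ?thesis using that by (simp add: integral_N borel_measurable_continuous_onI)
  qed
  obtain x0 where x0: "x0 \<in> X" using supp set_pmf_not_empty by fast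
  have "K \<noteq> {}" using K(3) x0 by auto
  have "closed K" using K(1) by (rule compact_imp_closed)
  have AE_K: "AE y in M. y \<in> K"
  proof -
    \<comment> \<open>A bounded continuous function that vanishes exactly on \<open>K\<close>. Its
      integral is 0 for every lifted measure, hence for the limit \<open>M\<close>, which is
      therefore carried by \<open>K\<close>.\<close>
    define u where "u y = min 1 (infdist y K)" for y
    have u: "continuous_on UNIV u" unfolding u_def by (intro continuous_intros)
    have u1: "norm (u y) \<le> 1" for y by (auto simp: u_def infdist_nonneg)
    have "measure_pmf.expectation (p (r n)) (\<lambda>x. u (\<kappa> x)) = 0" for n
    proof -
      have "measure_pmf.expectation (p (r n)) (\<lambda>x. u (\<kappa> x)) = measure_pmf.expectation (p (r n)) (\<lambda>x. 0)"
        by (rule integral_cong_AE) (use AE_X[of "r n"] \<kappa>(1) in \<open>auto simp: u_def elim!: eventually_mono\<close>)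
      then show ?thesis by simp
    qed
    with conv[OF u u1] have "integral\<^sup>L M u = 0" by (simp add: LIMSEQ_const_iff)
    moreover have "integrable M u"
      by (rule M.integrable_const_bound[of _ 1])
         (use u1 borel_measurable_continuous_onI[OF u] in auto)
    ultimately have "AE y in M. u y = 0"
      by (subst (asm) integral_nonneg_eq_0_iff_AE) (auto simp: u_def infdist_nonneg)
    then show ?thesis
    proof eventually_elim
      case (elim y)
      then have "infdist y K = 0" by (auto simp: u_def min_def split: if_splits)
      then show ?case using in_closed_iff_infdist_zero[OF \<open>closed K\<close> \<open>K \<noteq> {}\<close>] by simp
    qed
  qed
  \<comment> \<open>Off \<open>K\<close>, a null set for \<open>M\<close>, the value is a dummy
    point of \<open>X\<close>; this makes the map total, with values in \<open>X\<close>.\<close>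
  define \<pi>' where "\<pi>' y = (if y \<in> K then \<pi> y else x0)" for y
  have "\<pi>' \<in> borel_measurable borel"
    unfolding \<pi>'_def by (rule borel_measurable_continuous_on_if)
      (use K \<open>closed K\<close> in auto)
  then have \<pi>'_meas: "\<pi>' \<in> measurable M (restrict_space borel X)"
    by (intro measurable_restrict_space2) (use K(3) x0 in \<open>auto simp: \<pi>'_def\<close>)
  define \<mu> where "\<mu> = distr M (restrict_space borel X) \<pi>'"
  show ?thesis
  proof
    show "strict_mono r" by (rule r)
    show "prob_space \<mu>" unfolding \<mu>_def by (rule M.prob_space_distr[OF \<pi>'_meas])
    show "sets \<mu> = sets (restrict_space borel X)" by (simp add: \<mu>_def)
  next
    fix h :: "'a \<Rightarrow> real" assume h: "continuous_on X h"
    have hK: "continuous_on K (\<lambda>y. h (\<pi> y))"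
      by (rule continuous_on_compose2[OF h K(2)]) (use K in auto)
    obtain B where B: "B > 0" "\<And>y. y \<in> K \<Longrightarrow> \<bar>h (\<pi> y)\<bar> \<le> B"
      using compact_continuous_abs_bound[OF K(1) hK] by metis
    \<comment> \<open>Weak convergence on the line tests functions that are bounded and continuous
      everywhere, so \<open>h\<close> composed with \<open>\<pi>\<close> is extended from
      \<open>K\<close> by Tietze. As \<open>\<pi>\<close> undoes \<open>\<kappa>\<close>, the value
      \<open>u (\<kappa> x)\<close> is \<open>h x\<close> on \<open>X\<close>.\<close>
    obtain u where u: "continuous_on UNIV u" "\<And>y. y \<in> K \<Longrightarrow> u y = h (\<pi> y)" "\<And>y. norm (u y) \<le> B"
      using Tietze[of K "\<lambda>y. h (\<pi> y)" UNIV B] hK B \<open>closed K\<close> by auto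
    have h_meas: "h \<in> borel_measurable (restrict_space borel X)"
      by (rule borel_measurable_continuous_on_restrict[OF h])
    have "integral\<^sup>L \<mu> h = integral\<^sup>L M (\<lambda>y. h (\<pi>' y))"
      unfolding \<mu>_def by (rule integral_distr[OF \<pi>'_meas h_meas])
    also have "\<dots> = integral\<^sup>L M u"
    proof (rule integral_cong_AE)
      show "(\<lambda>y. h (\<pi>' y)) \<in> borel_measurable M"
        by (rule measurable_compose[OF \<pi>'_meas h_meas])
      show "u \<in> borel_measurable M"
        using borel_measurable_continuous_onI[OF u(1)] by simp
      show "AE y in M. h (\<pi>' y) = u y"
        using AE_K by eventually_elim (simp add: \<pi>'_def u(2))
    qed
    finally have "integral\<^sup>L \<mu> h = integral\<^sup>L M u" .
    moreover have "measure_pmf.expectation (p (r n)) (\<lambda>x. u (\<kappa> x)) = measure_pmf.expectation (p (r n)) h" for n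
      by (rule integral_cong_AE) (use AE_X[of "r n"] \<kappa> u(2) in \<open>auto elim!: eventually_mono\<close>)
    ultimately show "(\<lambda>n. measure_pmf.expectation (p (r n)) h) \<longlonglongrightarrow> integral\<^sup>L \<mu> h"
      using conv[OF u(1,3)] by simp
  qed
qed

section \<open>Continuous test functions: equality of measures and invariance\<close>

lemma space_eq_of_sets_restrict_borel:
  "sets \<mu> = sets (restrict_space borel X) \<Longrightarrow> space \<mu> = X"
  using sets_eq_imp_space_eq[of \<mu> "restrict_space borel X"] by (simp add: space_restrict_space)

lemma integrable_continuous_on_compact:
  fixes h :: "'a::metric_space \<Rightarrow> real"
  assumes "prob_space \<mu>" and "sets \<mu> = sets (restrict_space borel X)"
    and "compact X" and "continuous_on X h"
  shows "integrable \<mu> h"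
proof -
  interpret prob_space \<mu> by fact
  obtain B where B: "\<And>x. x \<in> X \<Longrightarrow> \<bar>h x\<bar> \<le> B"
    using compact_continuous_abs_bound[OF assms(3,4)] by metis
  show ?thesis
  proof (rule integrable_const_bound[of _ B])
    show "AE x in \<mu>. norm (h x) \<le> B"
      using B space_eq_of_sets_restrict_borel[OF assms(2)] by (intro AE_I2) auto
    show "h \<in> borel_measurable \<mu>"
      using borel_measurable_continuous_on_restrict[OF assms(4)]
      by (simp add: measurable_cong_sets[OF assms(2) refl])
  qed
qed

text \<open>The relatively open sets are stable under intersection and generate the Borel sets of
  \<open>X\<close>, and their measures are limits of integrals of continuous functions, the
  truncated multiples of the distance to the complement.\<close>

lemma prob_measure_eqI_continuous:
  fixes X :: "'a::metric_space set"
  assumes "compact X" "prob_space \<mu>" "prob_space \<nu>"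
    and sets: "sets \<mu> = sets (restrict_space borel X)" "sets \<nu> = sets (restrict_space borel X)"
    and eq: "\<And>h :: 'a \<Rightarrow> real. continuous_on X h \<Longrightarrow> integral\<^sup>L \<mu> h = integral\<^sup>L \<nu> h"
  shows "\<mu> = \<nu>"
proof -
  interpret \<mu>: prob_space \<mu> by fact
  interpret \<nu>: prob_space \<nu> by fact
  note sp = space_eq_of_sets_restrict_borel[OF sets(1)] space_eq_of_sets_restrict_borel[OF sets(2)]
  define E where "E = (\<lambda>U. X \<inter> U) ` {U. open U}"
  have sigma: "sets (restrict_space borel X) = sigma_sets X E"
  proof -
    have borel: "sets borel = sigma_sets UNIV {U::'a set. open U}" by (simp add: borel_def)
    have "X \<in> sets borel" using assms(1) by (simp add: compact_imp_closed)
    then show ?thesis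
      unfolding sets_restrict_space borel E_def by (intro sigma_sets_Int) auto
  qed
  have lim: "(\<lambda>k. integral\<^sup>L M (\<lambda>x. min 1 (real k * infdist x (- U)))) \<longlonglongrightarrow> measure M (X \<inter> U)"
    if M: "prob_space M" "sets M = sets (restrict_space borel X)" and U: "open U" "U \<noteq> UNIV" for M U
  proof -
    interpret prob_space M by fact
    have XU: "X \<inter> U \<in> sets M" using U unfolding M(2) sets_restrict_space by auto
    have meas: "(\<lambda>x. min 1 (real k * infdist x (- U))) \<in> borel_measurable M" for k
      unfolding measurable_cong_sets[OF M(2) refl]
      by (intro borel_measurable_continuous_on_restrict continuous_intros)
    have "(\<lambda>k. integral\<^sup>L M (\<lambda>x. min 1 (real k * infdist x (- U)))) \<longlonglongrightarrow> integral\<^sup>L M (indicator (X \<inter> U))"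
    proof (rule integral_dominated_convergence[where w="\<lambda>_. 1"])
      show "AE x in M. (\<lambda>k. min 1 (real k * infdist x (- U))) \<longlonglongrightarrow> indicator (X \<inter> U) x"
      proof (rule AE_I2)
        fix x assume "x \<in> space M"
        then have "x \<in> X" using space_eq_of_sets_restrict_borel[OF M(2)] by simp
        show "(\<lambda>k. min 1 (real k * infdist x (- U))) \<longlonglongrightarrow> indicator (X \<inter> U) x"
        proof (cases "x \<in> U")
          case True
          have "closed (- U)" "- U \<noteq> {}" using U by auto
          then have pos: "infdist x (- U) > 0"
            using in_closed_iff_infdist_zero[of "- U" x] infdist_nonneg[of x "- U"] True by fastforce
          obtain k0 where k0: "1 < real k0 * infdist x (- U)" using reals_Archimedean3[OF pos] by blast
          have "eventually (\<lambda>k. min 1 (real k * infdist x (- U)) = 1) sequentially"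
            using eventually_ge_at_top[of k0]
          proof eventually_elim
            case (elim k)
            have "real k0 * infdist x (- U) \<le> real k * infdist x (- U)"
              using elim pos by (intro mult_right_mono) auto
            then show ?case using k0 by (simp add: min_def)
          qed
          then show ?thesis using True \<open>x \<in> X\<close> by (simp add: tendsto_eventually)
        qed simp
      qed
    qed (use XU meas in \<open>auto simp: infdist_nonneg\<close>)
    then show ?thesis using XU by simp
  qed
  show ?thesis
  proof (rule measure_eqI_generator_eq[where E=E and \<Omega>=X and A="\<lambda>_. X"])
    show "Int_stable E"
    proof (rule Int_stableI)
      fix a b assume "a \<in> E" "b \<in> E"
      then obtain U V where "open U" "a = X \<inter> U" "open V" "b = X \<inter> V" by (auto simp: E_def)
      then have "a \<inter> b = X \<inter> (U \<inter> V)" "open (U \<inter> V)" by auto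
      then show "a \<inter> b \<in> E" by (auto simp: E_def)
    qed
    show "E \<subseteq> Pow X" by (auto simp: E_def)
    show "sets \<mu> = sigma_sets X E" "sets \<nu> = sigma_sets X E" using sigma sets by auto
    have "X = X \<inter> UNIV" "open (UNIV :: 'a set)" by auto
    then show "range (\<lambda>_. X) \<subseteq> E" unfolding E_def by blast
    show "emeasure \<mu> X \<noteq> \<infinity>" for i :: nat by simp
    fix A assume "A \<in> E"
    then obtain U where U: "open U" "A = X \<inter> U" by (auto simp: E_def)
    \<comment> \<open>\<open>infdist\<close> to the empty set is 0 by convention, so the
      approximation breaks down for \<open>U = UNIV\<close>; there both measures give 1.\<close>
    show "emeasure \<mu> A = emeasure \<nu> A"
    proof (cases "U = UNIV")
      case True
      then show ?thesis using U \<mu>.emeasure_space_1 \<nu>.emeasure_space_1 sp by simp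
    next
      case False
      have "(\<lambda>k. integral\<^sup>L \<mu> (\<lambda>x. min 1 (real k * infdist x (- U)))) \<longlonglongrightarrow> measure \<nu> A"
        using lim[OF assms(3) sets(2) U(1) False] U(2)
        by (subst eq) (auto intro!: continuous_intros)
      then have "measure \<mu> A = measure \<nu> A"
        using lim[OF assms(2) sets(1) U(1) False] U(2) LIMSEQ_unique by blast
      then show ?thesis by (simp add: \<mu>.emeasure_eq_measure \<nu>.emeasure_eq_measure)
    qed
  qed simp
qed

text \<open>Invariance says that the image of \<open>\<mu>\<close> under \<open>T\<close> is
  \<open>\<mu>\<close>, an equality of Borel probability measures, which continuous functions
  decide.\<close>

lemma invariant_measuresI_continuous:
  fixes X :: "'a::metric_space set"
  assumes "compact X" "prob_space \<mu>" and sets: "sets \<mu> = sets (restrict_space borel X)"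
    and T: "continuous_on X T" "T ` X \<subseteq> X"
    and inv: "\<And>h :: 'a \<Rightarrow> real. continuous_on X h \<Longrightarrow> integral\<^sup>L \<mu> (\<lambda>x. h (T x)) = integral\<^sup>L \<mu> h"
  shows "\<mu> \<in> invariant_measures X T"
proof -
  note sp = space_eq_of_sets_restrict_borel[OF sets]
  have "T \<in> measurable \<mu> (restrict_space borel X)"
    using borel_measurable_continuous_on_restrict[OF T(1)] T(2) sp
    by (intro measurable_restrict_space2) (auto simp: measurable_cong_sets[OF sets refl])
  then have Tm: "T \<in> measurable \<mu> \<mu>" by (simp add: measurable_cong_sets[OF refl sets])
  have "distr \<mu> \<mu> T = \<mu>"
  proof (rule prob_measure_eqI_continuous[OF assms(1) _ assms(2)])
    show "prob_space (distr \<mu> \<mu> T)" using assms(2) Tm by (rule prob_space.prob_space_distr)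
    fix h :: "'a \<Rightarrow> real" assume h: "continuous_on X h"
    have "h \<in> borel_measurable \<mu>"
      using borel_measurable_continuous_on_restrict[OF h] by (simp add: measurable_cong_sets[OF sets refl])
    then show "integral\<^sup>L (distr \<mu> \<mu> T) h = integral\<^sup>L \<mu> h"
      using Tm inv[OF h] by (simp add: integral_distr)
  qed (use sets in auto)
  then have "emeasure \<mu> (T -` B \<inter> space \<mu>) = emeasure \<mu> B" if "B \<in> sets \<mu>" for B
    using emeasure_distr[OF Tm that] by simp
  then show ?thesis using assms(2) sets Tm by (simp add: invariant_measures_def)
qed

section \<open>Products of upper triangular matrices\<close>

text \<open>
  With \<open>a\<close> and \<open>b\<close> the diagonal entries along an orbit, this is the coefficient of the \<open>k\<close>-th
  off-diagonal entry in the upper right corner of the \<open>n\<close>-fold matrix product.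
\<close>

definition triangular_weight :: "(nat \<Rightarrow> real) \<Rightarrow> (nat \<Rightarrow> real) \<Rightarrow> nat \<Rightarrow> nat \<Rightarrow> real" where
  "triangular_weight a b n k = (\<Prod>i=Suc k..<n. a i) * (\<Prod>i<k. b i)"

section \<open>Bounds on the weights, uniform in the length of the product\<close>

lemma triangular_weight_nonneg:
  assumes "\<And>i. 0 \<le> a i" "\<And>i. 0 \<le> b i"
  shows "0 \<le> triangular_weight a b n k"
  using assms by (auto simp: triangular_weight_def intro!: mult_nonneg_nonneg prod_nonneg)

lemma triangular_weight_le_1:
  assumes "\<And>i. 0 \<le> a i \<and> a i \<le> 1" "\<And>i. 0 \<le> b i \<and> b i \<le> 1"
  shows "triangular_weight a b n k \<le> 1"
  unfolding triangular_weight_def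
  using assms by (intro mult_le_one prod_le_1 prod_nonneg) auto

text \<open>Weight \<open>k\<close> omits the factor \<open>a k\<close>, so multiplying it by
  \<open>1 - a k\<close> gives, up to a factor at most 1, a difference of consecutive products
  \<open>P\<close>, and these telescope. Thus little mass sits where \<open>a\<close> is away from
  1.\<close>

lemma triangular_weight_defect_left:
  assumes a: "\<And>i. 0 \<le> a i \<and> a i \<le> 1" and b: "\<And>i. 0 \<le> b i \<and> b i \<le> 1"
  shows "(\<Sum>k<n. triangular_weight a b n k * (1 - a k)) \<le> 1"
proof -
  define P where "P k = (\<Prod>i=k..<n. a i)" for k
  have P: "0 \<le> P k" "P k \<le> 1" for k
    using a by (auto simp: P_def intro!: prod_nonneg prod_le_1)
  have "triangular_weight a b n k * (1 - a k) \<le> P (Suc k) - P k" if "k < n" for k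
  proof -
    have "(\<Prod>i<k. b i) \<le> 1" using b by (intro prod_le_1) auto
    then have "P (Suc k) * (\<Prod>i<k. b i) * (1 - a k) \<le> P (Suc k) * 1 * (1 - a k)"
      using a P by (intro mult_right_mono mult_left_mono) auto
    also have "\<dots> = P (Suc k) - P k"
      using that by (simp add: P_def prod.atLeast_Suc_lessThan algebra_simps)
    finally show ?thesis by (simp add: triangular_weight_def P_def)
  qed
  then have "(\<Sum>k<n. triangular_weight a b n k * (1 - a k)) \<le> (\<Sum>k<n. P (Suc k) - P k)"
    by (intro sum_mono) auto
  also have "\<dots> = P n - P 0" by (rule sum_lessThan_telescope)
  finally show ?thesis using P(2)[of n] P(1)[of 0] by linarith
qed

text \<open>The mirror image: the initial products of \<open>b\<close> telescope, and the factor
  coming from \<open>a\<close> is estimated by 1.\<close>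

lemma triangular_weight_defect_right:
  assumes a: "\<And>i. 0 \<le> a i \<and> a i \<le> 1" and b: "\<And>i. 0 \<le> b i \<and> b i \<le> 1"
  shows "(\<Sum>k<n. triangular_weight a b n k * (1 - b k)) \<le> 1"
proof -
  define G where "G k = (\<Prod>i<k. b i)" for k
  have G: "0 \<le> G k" "G k \<le> 1" for k
    using b by (auto simp: G_def intro!: prod_nonneg prod_le_1)
  have "triangular_weight a b n k * (1 - b k) \<le> G k - G (Suc k)" for k
  proof -
    have "(\<Prod>i=Suc k..<n. a i) \<le> 1" using a by (intro prod_le_1) auto
    then have "(\<Prod>i=Suc k..<n. a i) * G k * (1 - b k) \<le> 1 * G k * (1 - b k)"
      using b G by (intro mult_right_mono) auto
    also have "\<dots> = G k - G (Suc k)" by (simp add: G_def algebra_simps)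
    finally show ?thesis by (simp add: triangular_weight_def G_def)
  qed
  then have "(\<Sum>k<n. triangular_weight a b n k * (1 - b k)) \<le> (\<Sum>k<n. G k - G (Suc k))"
    by (intro sum_mono) auto
  also have "\<dots> = G 0 - G n" by (rule sum_lessThan_telescope')
  finally show ?thesis using G(2)[of 0] G(1)[of n] by linarith
qed

text \<open>A discrete product rule splits each increment into a rise of \<open>P\<close> and a fall
  of \<open>G\<close>, each with a factor in [0, 1]. Both sequences are monotone within [0, 1], so
  each contributes at most 1.\<close>

lemma triangular_weight_variation:
  assumes a: "\<And>i. 0 \<le> a i \<and> a i \<le> 1" and b: "\<And>i. 0 \<le> b i \<and> b i \<le> 1"
  shows "(\<Sum>k<n. \<bar>triangular_weight a b n (Suc k) - triangular_weight a b n k\<bar>) \<le> 2"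
proof -
  define P where "P k = (\<Prod>i=k..<n. a i)" for k
  define G where "G k = (\<Prod>i<k. b i)" for k
  have P: "0 \<le> P k" "P k \<le> 1" for k
    using a by (auto simp: P_def intro!: prod_nonneg prod_le_1)
  have G: "0 \<le> G k" "G k \<le> 1" for k
    using b by (auto simp: G_def intro!: prod_nonneg prod_le_1)
  have P_mono: "P k \<le> P (Suc k)" for k
  proof (cases "k < n")
    case True
    then have "P k = a k * P (Suc k)" by (simp add: P_def prod.atLeast_Suc_lessThan)
    then show ?thesis using a[of k] P(1)[of "Suc k"] by (simp add: mult_left_le_one_le)
  qed (simp add: P_def)
  have G_mono: "G (Suc k) \<le> G k" for k
    using b[of k] G(1)[of k] by (simp add: G_def mult_left_le)
  have "\<bar>triangular_weight a b n (Suc k) - triangular_weight a b n k\<bar>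
      \<le> (G k - G (Suc k)) + (P (Suc (Suc k)) - P (Suc k))" for k
  proof -
    have "triangular_weight a b n (Suc k) - triangular_weight a b n k
        = (P (Suc (Suc k)) - P (Suc k)) * G k - P (Suc (Suc k)) * (G k - G (Suc k))"
      by (simp add: triangular_weight_def P_def G_def algebra_simps)
    moreover have "0 \<le> (P (Suc (Suc k)) - P (Suc k)) * G k"
      "(P (Suc (Suc k)) - P (Suc k)) * G k \<le> P (Suc (Suc k)) - P (Suc k)"
      using P_mono[of "Suc k"] G[of k] by (auto simp: mult_left_le)
    moreover have "0 \<le> P (Suc (Suc k)) * (G k - G (Suc k))"
      "P (Suc (Suc k)) * (G k - G (Suc k)) \<le> G k - G (Suc k)"
      using G_mono[of k] P[of "Suc (Suc k)"] by (auto simp: mult_left_le_one_le)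
    ultimately show ?thesis by linarith
  qed
  then have "(\<Sum>k<n. \<bar>triangular_weight a b n (Suc k) - triangular_weight a b n k\<bar>)
      \<le> (\<Sum>k<n. (G k - G (Suc k)) + (P (Suc (Suc k)) - P (Suc k)))"
    by (intro sum_mono) auto
  also have "\<dots> = (G 0 - G n) + (P (Suc n) - P (Suc 0))"
    unfolding sum.distrib sum_lessThan_telescope' using sum_lessThan_telescope[of "\<lambda>k. P (Suc k)" n] by simp
  finally show ?thesis using G(2)[of 0] G(1)[of n] P(2)[of "Suc n"] P(1)[of "Suc 0"] by linarith
qed

lemma summation_by_parts_lessThan:
  fixes w u :: "nat \<Rightarrow> real"
  shows "(\<Sum>k<n. w k * (u (Suc k) - u k)) = w n * u n - w 0 * u 0 - (\<Sum>k<n. (w (Suc k) - w k) * u (Suc k))"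
  by (induction n) (simp_all add: algebra_simps)

text \<open>After summation by parts, the two boundary terms cost \<open>H\<close> each and the
  variation of the weights costs \<open>2 * H\<close>. As the bound is free of \<open>n\<close>,
  weighted orbit measures of large mass become nearly invariant when normalised.\<close>

lemma triangular_weight_shift:
  assumes a: "\<And>i. 0 \<le> a i \<and> a i \<le> 1" and b: "\<And>i. 0 \<le> b i \<and> b i \<le> 1"
    and u: "\<And>k. \<bar>u k\<bar> \<le> H"
  shows "\<bar>\<Sum>k<n. triangular_weight a b n k * (u (Suc k) - u k)\<bar> \<le> 4 * H"
proof -
  let ?w = "triangular_weight a b n"
  have H: "0 \<le> H" using u[of 0] by linarith
  have end_le: "\<bar>?w k * u k\<bar> \<le> H" for k
  proof -
    have "\<bar>?w k\<bar> * \<bar>u k\<bar> \<le> 1 * H"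
      using triangular_weight_nonneg[of a b n k] triangular_weight_le_1[of a b n k] a b u
      by (intro mult_mono) auto
    then show ?thesis by (simp add: abs_mult)
  qed
  have "\<bar>\<Sum>k<n. (?w (Suc k) - ?w k) * u (Suc k)\<bar> \<le> (\<Sum>k<n. \<bar>(?w (Suc k) - ?w k) * u (Suc k)\<bar>)"
    by (rule sum_abs)
  also have "\<dots> \<le> (\<Sum>k<n. \<bar>?w (Suc k) - ?w k\<bar> * H)"
    by (intro sum_mono) (simp add: abs_mult mult_left_mono u)
  also have "\<dots> \<le> 2 * H"
    unfolding sum_distrib_right[symmetric]
    by (intro mult_right_mono triangular_weight_variation a b H)
  finally show ?thesis
    unfolding summation_by_parts_lessThan using end_le[of n] end_le[of 0] by linarith
qed

section \<open>From the matrix product to its upper right corner\<close>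

lemma uptri_matrix_mult: "uptri a c b ** uptri a' c' b' = uptri (a * a') (a * c' + c * b') (b * b')"
  by (simp add: vec_eq_iff uptri_def matrix_matrix_mult_def forall_2 sum_2)

lemma cocycle_uptri:
  "cocycle (\<lambda>x. uptri (f x) (\<phi> x) (g x)) T n x =
     uptri (\<Prod>i<n. f ((T ^^ i) x))
       (\<Sum>k<n. triangular_weight (\<lambda>i. f ((T ^^ i) x)) (\<lambda>i. g ((T ^^ i) x)) n k * \<phi> ((T ^^ k) x))
       (\<Prod>i<n. g ((T ^^ i) x))"
proof (induction n)
  case 0
  show ?case by (simp add: vec_eq_iff uptri_def mat_def forall_2)
next
  case (Suc n)
  let ?a = "\<lambda>i. f ((T ^^ i) x)" and ?b = "\<lambda>i. g ((T ^^ i) x)"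
  \<comment> \<open>The new left factor multiplies every earlier coefficient by \<open>?a n\<close>;
    the new term \<open>k = n\<close> carries the product of the \<open>?b i\<close> alone.\<close>
  have "triangular_weight ?a ?b (Suc n) k = ?a n * triangular_weight ?a ?b n k" if "k < n" for k
    using that by (simp add: triangular_weight_def prod.atLeastLessThan_Suc)
  then have "(\<Sum>k<Suc n. triangular_weight ?a ?b (Suc n) k * \<phi> ((T ^^ k) x)) =
      ?a n * (\<Sum>k<n. triangular_weight ?a ?b n k * \<phi> ((T ^^ k) x)) + \<phi> ((T ^^ n) x) * (\<Prod>i<n. ?b i)"
    by (simp add: sum_distrib_left triangular_weight_def mult_ac)
  then show ?case
    by (simp add: Suc.IH uptri_matrix_mult mult_ac del: sum.lessThan_Suc)
qed

lemma mnorm_uptri_bounds: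
  shows "\<bar>c\<bar> \<le> mnorm (uptri a c b)" and "mnorm (uptri a c b) \<le> \<bar>a\<bar> + \<bar>c\<bar> + \<bar>b\<bar>"
  using matrix_component_le_onorm[of "uptri a c b" 1 2] onorm_le_matrix_component_sum[of "uptri a c b"]
  by (simp_all add: mnorm_def uptri_def sum_2)

text \<open>The distribution lives on the indices and not on the orbit, so a point visited
  repeatedly collects its masses when the pmf is pushed forward along the orbit.\<close>

lemma finitely_weighted_pmf:
  fixes w :: "nat \<Rightarrow> real"
  assumes "\<And>k. 0 \<le> w k" and "0 < (\<Sum>k<n. w k)"
  obtains q :: "nat pmf" where
    "\<And>h :: nat \<Rightarrow> real. measure_pmf.expectation q h = (\<Sum>k<n. w k * h k) / (\<Sum>k<n. w k)"
proof -
  define v where "v k = (if k < n then w k / (\<Sum>k<n. w k) else 0)" for k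
  have nonneg: "0 \<le> v k" for k using assms by (simp add: v_def)
  have "(\<Sum>k<n. v k) = 1" using assms(2) by (simp add: v_def flip: sum_divide_distrib)
  then have "(\<Sum>k<n. ennreal (v k)) = 1" using nonneg by simp
  then have "(\<integral>\<^sup>+k. ennreal (v k) \<partial>count_space UNIV) = 1"
    by (subst nn_integral_count_space'[of "{..<n}"]) (simp_all add: v_def)
  then have q: "pmf (embed_pmf v) k = v k" for k by (rule pmf_embed_pmf[OF nonneg])
  show ?thesis
  proof
    fix h :: "nat \<Rightarrow> real"
    have "measure_pmf.expectation (embed_pmf v) h = (\<Sum>k<n. h k * v k)"
      by (subst integral_measure_pmf_real[of "{..<n}"]) (auto simp: set_pmf_iff q v_def split: if_splits)
    then show "measure_pmf.expectation (embed_pmf v) h = (\<Sum>k<n. w k * h k) / (\<Sum>k<n. w k)"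
      by (simp add: v_def sum_divide_distrib mult.commute)
  qed
qed

section \<open>Growth of the cocycle\<close>

lemma invariant_measuresD:
  assumes "\<mu> \<in> invariant_measures X T"
  shows "prob_space \<mu>" "sets \<mu> = sets (restrict_space borel X)" "space \<mu> = X" "T \<in> measurable \<mu> \<mu>"
    "distr \<mu> \<mu> T = \<mu>"
proof -
  show "prob_space \<mu>" "sets \<mu> = sets (restrict_space borel X)" and T: "T \<in> measurable \<mu> \<mu>"
    using assms by (auto simp: invariant_measures_def)
  then show "space \<mu> = X" by (intro space_eq_of_sets_restrict_borel)
  show "distr \<mu> \<mu> T = \<mu>"
    by (rule measure_eqI) (use assms T in \<open>auto simp: invariant_measures_def emeasure_distr\<close>)
qed

lemma integral_invariant_funpow:
  fixes h :: "'a::metric_space \<Rightarrow> real"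
  assumes \<mu>: "\<mu> \<in> invariant_measures X T" and h: "h \<in> borel_measurable \<mu>"
  shows "integral\<^sup>L \<mu> (\<lambda>x. h ((T ^^ k) x)) = integral\<^sup>L \<mu> h"
proof (induction k)
  case (Suc k)
  have T: "T \<in> measurable \<mu> \<mu>" by (rule invariant_measuresD[OF \<mu>])
  have "T ^^ k \<in> measurable \<mu> \<mu>"
    by (rule measurable_compose_n) (rule T)
  then have "(\<lambda>x. h ((T ^^ k) x)) \<in> borel_measurable \<mu>" using h by (rule measurable_compose)
  then have "integral\<^sup>L (distr \<mu> \<mu> T) (\<lambda>x. h ((T ^^ k) x)) = integral\<^sup>L \<mu> (\<lambda>x. h ((T ^^ k) (T x)))"
    by (rule integral_distr[OF T])
  then show ?case by (simp add: invariant_measuresD(5)[OF \<mu>] Suc.IH funpow_swap1)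
qed simp

section \<open>The cocycle over a compact system\<close>

locale triangular_cocycle =
  fixes X :: "'a::metric_space set" and T :: "'a \<Rightarrow> 'a" and f g \<phi> :: "'a \<Rightarrow> real"
  assumes compact_X: "compact X" and nonempty_X: "X \<noteq> {}"
    and continuous_T: "continuous_on X T" and T_into: "T ` X \<subseteq> X"
    and continuous_f: "continuous_on X f" and continuous_g: "continuous_on X g"
    and continuous_\<phi>: "continuous_on X \<phi>"
    and f_range: "x \<in> X \<Longrightarrow> 0 < f x \<and> f x \<le> 1"
    and g_range: "x \<in> X \<Longrightarrow> 0 < g x \<and> g x \<le> 1"
begin

abbreviation weight :: "nat \<Rightarrow> 'a \<Rightarrow> nat \<Rightarrow> real" where
  "weight n x \<equiv> triangular_weight (\<lambda>i. f ((T ^^ i) x)) (\<lambda>i. g ((T ^^ i) x)) n"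

definition corner :: "nat \<Rightarrow> 'a \<Rightarrow> real" where
  "corner n x = (\<Sum>k<n. weight n x k * \<phi> ((T ^^ k) x))"

lemma funpow_into: "x \<in> X \<Longrightarrow> (T ^^ k) x \<in> X"
  using T_into by (induction k) auto

lemma continuous_funpow: "continuous_on X (T ^^ k)"
proof (induction k)
  case (Suc k)
  have "continuous_on X (\<lambda>x. T ((T ^^ k) x))"
    by (rule continuous_on_compose2[OF continuous_T Suc.IH]) (use funpow_into in auto)
  then show ?case by (simp add: o_def)
qed (simp add: id_def)

lemma continuous_compose_funpow:
  "continuous_on X h \<Longrightarrow> continuous_on X (\<lambda>x. h ((T ^^ k) x))"
  by (rule continuous_on_compose2[OF _ continuous_funpow]) (use funpow_into in auto)

lemma orbit_f_range: "x \<in> X \<Longrightarrow> 0 \<le> f ((T ^^ i) x) \<and> f ((T ^^ i) x) \<le> 1"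
  and orbit_g_range: "x \<in> X \<Longrightarrow> 0 \<le> g ((T ^^ i) x) \<and> g ((T ^^ i) x) \<le> 1"
  using f_range g_range funpow_into by (auto intro: less_imp_le)

lemma continuous_corner: "continuous_on X (corner n)"
  unfolding corner_def triangular_weight_def
  by (intro continuous_intros continuous_compose_funpow continuous_f continuous_g continuous_\<phi>)

text \<open>The diagonal entries are products of numbers in [0, 1] and account for the 2, which
  disappears after division by \<open>n\<close>.\<close>

lemma mnorm_cocycle_bounds:
  assumes "x \<in> X"
  shows "\<bar>corner n x\<bar> \<le> mnorm (cocycle (\<lambda>x. uptri (f x) (\<phi> x) (g x)) T n x)"
    and "mnorm (cocycle (\<lambda>x. uptri (f x) (\<phi> x) (g x)) T n x) \<le> \<bar>corner n x\<bar> + 2"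
proof -
  have "0 \<le> (\<Prod>i<n. f ((T ^^ i) x))" "(\<Prod>i<n. f ((T ^^ i) x)) \<le> 1"
    "0 \<le> (\<Prod>i<n. g ((T ^^ i) x))" "(\<Prod>i<n. g ((T ^^ i) x)) \<le> 1"
    using orbit_f_range[OF assms] orbit_g_range[OF assms] by (auto intro!: prod_nonneg prod_le_1)
  then show "\<bar>corner n x\<bar> \<le> mnorm (cocycle (\<lambda>x. uptri (f x) (\<phi> x) (g x)) T n x)"
    and "mnorm (cocycle (\<lambda>x. uptri (f x) (\<phi> x) (g x)) T n x) \<le> \<bar>corner n x\<bar> + 2"
    using mnorm_uptri_bounds[where c="corner n x" and a="\<Prod>i<n. f ((T ^^ i) x)" and b="\<Prod>i<n. g ((T ^^ i) x)"]
    unfolding cocycle_uptri corner_def[symmetric] by linarith+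
qed

lemma bdd_above_mnorm_cocycle:
  "bdd_above ((\<lambda>x. mnorm (cocycle (\<lambda>x. uptri (f x) (\<phi> x) (g x)) T n x)) ` X)"
proof -
  obtain B where B: "\<And>x. x \<in> X \<Longrightarrow> \<bar>corner n x\<bar> \<le> B"
    using compact_continuous_abs_bound[OF compact_X continuous_corner] by metis
  show ?thesis
  proof (rule bdd_aboveI2)
    fix x assume "x \<in> X"
    then show "mnorm (cocycle (\<lambda>x. uptri (f x) (\<phi> x) (g x)) T n x) \<le> B + 2"
      using B[of x] mnorm_cocycle_bounds(2)[of x n] by linarith
  qed
qed

text \<open>Lower half of the growth estimate. As \<open>ln f\<close> and \<open>ln g\<close> are at
  most 0, vanishing integrals force \<open>f = g = 1\<close> almost everywhere, and by invariance at
  all times along almost every orbit; then all weights are 1.\<close>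

lemma integral_le_corner_bound:
  assumes \<mu>: "\<mu> \<in> invariant_measures X T"
    and "integral\<^sup>L \<mu> (\<lambda>x. ln (f x)) = 0" "integral\<^sup>L \<mu> (\<lambda>x. ln (g x)) = 0"
    and bound: "\<And>x. x \<in> X \<Longrightarrow> \<bar>corner n x\<bar> \<le> M"
  shows "real n * \<bar>integral\<^sup>L \<mu> \<phi>\<bar> \<le> M"
proof -
  note D = invariant_measuresD[OF \<mu>]
  interpret prob_space \<mu> by (rule D)
  have int: "integrable \<mu> h" if "continuous_on X h" for h :: "'a \<Rightarrow> real"
    by (rule integrable_continuous_on_compact[OF D(1,2) compact_X that])
  have AE_1: "AE x in \<mu>. \<forall>k. u ((T ^^ k) x) = 1"
    if u: "continuous_on X u" "\<And>x. x \<in> X \<Longrightarrow> 0 < u x \<and> u x \<le> 1" "integral\<^sup>L \<mu> (\<lambda>x. ln (u x)) = 0" for u :: "'a \<Rightarrow> real"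
  proof (subst AE_all_countable, rule allI)
    fix k
    have ln: "continuous_on X (\<lambda>x. - ln (u x))"
      using u(1,2) by (intro continuous_on_minus continuous_on_ln) force+
    have "integral\<^sup>L \<mu> (\<lambda>x. - ln (u ((T ^^ k) x))) = 0"
      using integral_invariant_funpow[OF \<mu>, of "\<lambda>x. - ln (u x)" k] int[OF ln] u(3) by simp
    then have "AE x in \<mu>. - ln (u ((T ^^ k) x)) = 0"
      using u(2) funpow_into D(3) int[OF continuous_compose_funpow[OF ln]]
      by (subst (asm) integral_nonneg_eq_0_iff_AE) auto
    then show "AE x in \<mu>. u ((T ^^ k) x) = 1"
      using AE_space
    proof eventually_elim
      case (elim x)
      then have "0 < u ((T ^^ k) x)" using u(2) funpow_into D(3) by auto
      then show ?case using elim by simp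
    qed
  qed
  have "AE x in \<mu>. \<forall>k. f ((T ^^ k) x) = 1" "AE x in \<mu>. \<forall>k. g ((T ^^ k) x) = 1"
    using AE_1[OF continuous_f] AE_1[OF continuous_g] f_range g_range assms(2,3) by blast+
  then have "AE x in \<mu>. corner n x = (\<Sum>k<n. \<phi> ((T ^^ k) x))"
    by eventually_elim (simp add: corner_def triangular_weight_def)
  then have "integral\<^sup>L \<mu> (corner n) = integral\<^sup>L \<mu> (\<lambda>x. \<Sum>k<n. \<phi> ((T ^^ k) x))"
    using int[OF continuous_corner] int[OF continuous_compose_funpow[OF continuous_\<phi>]]
    by (intro integral_cong_AE) auto
  also have "\<dots> = (\<Sum>k<n. integral\<^sup>L \<mu> (\<lambda>x. \<phi> ((T ^^ k) x)))"
    by (intro Bochner_Integration.integral_sum int continuous_compose_funpow continuous_\<phi>)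
  also have "\<dots> = real n * integral\<^sup>L \<mu> \<phi>"
    using integral_invariant_funpow[OF \<mu>, of \<phi>] int[OF continuous_\<phi>] by simp
  finally have "real n * \<bar>integral\<^sup>L \<mu> \<phi>\<bar> = \<bar>integral\<^sup>L \<mu> (corner n)\<bar>" by (simp add: abs_mult)
  also have "\<dots> \<le> integral\<^sup>L \<mu> (\<lambda>x. \<bar>corner n x\<bar>)" by (rule integral_abs_bound)
  also have "\<dots> \<le> M"
    using int[OF continuous_corner] bound D(3) by (intro integral_le_const AE_I2) auto
  finally show ?thesis .
qed

text \<open>Upper half of the growth estimate: \<open>\<mu>\<close> is a weak limit of orbit
  measures, weighted by the coefficients that occur in the large corners.\<close>

lemma exists_measure_of_large_corners:
  assumes "0 < c" and large: "\<exists>\<^sub>\<infinity>n. \<exists>x\<in>X. real n * c \<le> \<bar>corner n x\<bar>"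
  obtains \<mu> where "\<mu> \<in> invariant_measures X T"
    "integral\<^sup>L \<mu> (\<lambda>x. ln (f x)) = 0" "integral\<^sup>L \<mu> (\<lambda>x. ln (g x)) = 0" "c \<le> \<bar>integral\<^sup>L \<mu> \<phi>\<bar>"
proof -
  obtain s0 :: "nat \<Rightarrow> nat" where s0: "strict_mono s0" "\<And>j. \<exists>x\<in>X. real (s0 j) * c \<le> \<bar>corner (s0 j) x\<bar>"
    using infinite_enumerate[OF large[unfolded INFM_iff_infinite]] by auto
  \<comment> \<open>The shift drops \<open>s0 0\<close>, which may be 0 and would give an empty sum;
    with \<open>Suc j \<le> s j\<close> every mass \<open>W j\<close> is positive.\<close>
  define s where "s j = s0 (Suc j)" for j
  have s_ge: "Suc j \<le> s j" for j
    using strict_mono_imp_increasing[OF s0(1), of "Suc j"] by (simp add: s_def)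
  obtain x where x: "\<And>j. x j \<in> X" "\<And>j. real (s j) * c \<le> \<bar>corner (s j) (x j)\<bar>"
    using s0(2)[of "Suc j" for j] unfolding s_def by metis
  obtain B where B: "B > 0" "\<And>x. x \<in> X \<Longrightarrow> \<bar>\<phi> x\<bar> \<le> B"
    using compact_continuous_abs_bound[OF compact_X continuous_\<phi>] by metis
  define w where "w j = weight (s j) (x j)" for j
  define W where "W j = (\<Sum>k<s j. w j k)" for j
  have w: "0 \<le> w j k" "w j k \<le> 1" for j k
    unfolding w_def using orbit_f_range[OF x(1)] orbit_g_range[OF x(1)]
    by (auto intro: triangular_weight_nonneg triangular_weight_le_1)
  \<comment> \<open>A corner of modulus at least \<open>s j * c\<close>, formed from values of
    \<open>\<phi>\<close> bounded by \<open>B\<close>, requires mass at least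
    \<open>s j * c / B\<close>; so \<open>W\<close> tends to infinity.\<close>
  have W_ge: "real (Suc j) * (c / B) \<le> W j" for j
  proof -
    have "real (Suc j) * c \<le> real (s j) * c"
      using s_ge[of j] \<open>0 < c\<close> by (intro mult_right_mono) auto
    also have "\<dots> \<le> \<bar>corner (s j) (x j)\<bar>" by (rule x)
    also have "\<dots> \<le> (\<Sum>k<s j. \<bar>w j k * \<phi> ((T ^^ k) (x j))\<bar>)"
      unfolding corner_def w_def by (rule sum_abs)
    also have "\<dots> \<le> (\<Sum>k<s j. w j k * B)"
      using w B(2)[OF funpow_into[OF x(1)]] by (intro sum_mono) (simp add: abs_mult mult_left_mono)
    also have "\<dots> = W j * B" by (simp add: W_def sum_distrib_right)
    finally show ?thesis using B(1) by (simp add: field_simps)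
  qed
  have W_pos: "0 < W j" for j
    using W_ge[of j] \<open>0 < c\<close> B(1) by (smt (verit) divide_pos_pos mult_pos_pos of_nat_0_less_iff zero_less_Suc)
  have W_le: "W j \<le> real (s j)" for j
    unfolding W_def using sum_mono[of "{..<s j}" "w j" "\<lambda>_. 1"] w(2) by simp
  have W_lim: "(\<lambda>j. C / W j) \<longlonglongrightarrow> 0" for C
  proof -
    have lim: "(\<lambda>j. inverse (real (Suc j)) * (B / c)) \<longlonglongrightarrow> 0"
      by (rule tendsto_mult_left_zero[OF LIMSEQ_inverse_real_of_nat])
    have "(\<lambda>j. 1 / W j) \<longlonglongrightarrow> 0"
    proof (rule tendsto_sandwich[OF _ _ tendsto_const lim])
      show "eventually (\<lambda>j. 0 \<le> 1 / W j) sequentially" using W_pos by (simp add: less_imp_le)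
      have "1 / W j \<le> 1 / (real (Suc j) * (c / B))" for j
        using W_ge[of j] \<open>0 < c\<close> B(1) by (intro divide_left_mono mult_pos_pos W_pos) auto
      moreover have "1 / (real (Suc j) * (c / B)) = inverse (real (Suc j)) * (B / c)" for j
        by (simp add: divide_inverse)
      ultimately show "eventually (\<lambda>j. 1 / W j \<le> inverse (real (Suc j)) * (B / c)) sequentially"
        by simp
    qed
    from tendsto_mult_right_zero[OF this, of C] show ?thesis by simp
  qed
  have "\<exists>q. \<forall>h :: nat \<Rightarrow> real. measure_pmf.expectation q h = (\<Sum>k<s j. w j k * h k) / W j" for j
    using finitely_weighted_pmf[of "w j" "s j"] w(1) W_pos[of j] unfolding W_def by metis
  then obtain q where q: "\<And>j (h :: nat \<Rightarrow> real). measure_pmf.expectation (q j) h = (\<Sum>k<s j. w j k * h k) / W j"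
    by metis
  define p where "p j = map_pmf (\<lambda>k. (T ^^ k) (x j)) (q j)" for j
  have p: "measure_pmf.expectation (p j) h = (\<Sum>k<s j. w j k * h ((T ^^ k) (x j))) / W j"
    for j and h :: "'a \<Rightarrow> real"
    by (simp add: p_def q)
  have "set_pmf (p j) \<subseteq> X" for j
    using funpow_into[OF x(1)] by (auto simp: p_def)
  then obtain r \<mu> where r: "strict_mono r" and \<mu>: "prob_space \<mu>" "sets \<mu> = sets (restrict_space borel X)"
    and conv: "\<And>h :: 'a \<Rightarrow> real. continuous_on X h \<Longrightarrow>
       (\<lambda>n. measure_pmf.expectation (p (r n)) h) \<longlonglongrightarrow> integral\<^sup>L \<mu> h"
    using pmf_compact_weakly_convergent_subsequence[OF compact_X, of p] by metis
  interpret prob_space \<mu> by fact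
  have sp: "space \<mu> = X" by (rule space_eq_of_sets_restrict_borel[OF \<mu>(2)])
  have int: "integrable \<mu> h" if "continuous_on X h" for h :: "'a \<Rightarrow> real"
    by (rule integrable_continuous_on_compact[OF \<mu> compact_X that])
  have W_lim': "(\<lambda>n. C / W (r n)) \<longlonglongrightarrow> 0" for C
    using LIMSEQ_subseq_LIMSEQ[OF W_lim r, of C] by (simp add: o_def)
  have "\<mu> \<in> invariant_measures X T"
  proof (rule invariant_measuresI_continuous[OF compact_X \<mu> continuous_T T_into])
    fix h :: "'a \<Rightarrow> real" assume h: "continuous_on X h"
    obtain H where H: "\<And>x. x \<in> X \<Longrightarrow> \<bar>h x\<bar> \<le> H"
      using compact_continuous_abs_bound[OF compact_X h] by metis
    have hT: "continuous_on X (\<lambda>x. h (T x))"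
      using continuous_compose_funpow[OF h, of 1] by simp
    \<comment> \<open>Applying \<open>T\<close> moves the orbit index by one, so the difference is
      the sum bounded in \<open>triangular_weight_shift\<close>, divided by the mass.\<close>
    have "\<bar>measure_pmf.expectation (p j) (\<lambda>x. h (T x)) - measure_pmf.expectation (p j) h\<bar> \<le> 4 * H / W j" for j
    proof -
      have "measure_pmf.expectation (p j) (\<lambda>x. h (T x)) - measure_pmf.expectation (p j) h
         = (\<Sum>k<s j. w j k * (h ((T ^^ Suc k) (x j)) - h ((T ^^ k) (x j)))) / W j"
        unfolding p by (simp add: right_diff_distrib sum_subtractf diff_divide_distrib)
      moreover have "\<bar>\<Sum>k<s j. w j k * (h ((T ^^ Suc k) (x j)) - h ((T ^^ k) (x j)))\<bar> \<le> 4 * H"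
        unfolding w_def
        by (rule triangular_weight_shift[of _ _ "\<lambda>k. h ((T ^^ k) (x j))"])
           (use orbit_f_range[OF x(1)] orbit_g_range[OF x(1)] H[OF funpow_into[OF x(1)]] in auto)
      ultimately show ?thesis using W_pos[of j] by (simp add: divide_right_mono)
    qed
    then have "(\<lambda>n. measure_pmf.expectation (p (r n)) (\<lambda>x. h (T x)) - measure_pmf.expectation (p (r n)) h) \<longlonglongrightarrow> 0"
      by (intro Lim_null_comparison[OF _ W_lim'[of "4 * H"]]) auto
    moreover have "(\<lambda>n. measure_pmf.expectation (p (r n)) (\<lambda>x. h (T x)) - measure_pmf.expectation (p (r n)) h)
        \<longlonglongrightarrow> integral\<^sup>L \<mu> (\<lambda>x. h (T x)) - integral\<^sup>L \<mu> h"
      by (intro tendsto_diff conv h hT)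
    ultimately show "integral\<^sup>L \<mu> (\<lambda>x. h (T x)) = integral\<^sup>L \<mu> h"
      using LIMSEQ_unique by fastforce
  qed
  \<comment> \<open>Before normalisation the defect sum is at most 1, so the nonnegative function
    \<open>1 - u\<close> has expectation at most \<open>1 / W j\<close> under \<open>p j\<close> and
    integral 0 in the limit; hence \<open>u = 1\<close> almost everywhere.\<close>
  moreover have ln0: "integral\<^sup>L \<mu> (\<lambda>x. ln (u x)) = 0"
    if u: "continuous_on X u" "\<And>x. x \<in> X \<Longrightarrow> 0 < u x \<and> u x \<le> 1"
      and defect: "\<And>j. (\<Sum>k<s j. w j k * (1 - u ((T ^^ k) (x j)))) \<le> 1" for u :: "'a \<Rightarrow> real"
  proof -
    have u1: "continuous_on X (\<lambda>x. 1 - u x)" by (intro continuous_intros u)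
    have nonneg: "0 \<le> (\<Sum>k<s j. w j k * (1 - u ((T ^^ k) (x j))))" for j
      using w u(2)[OF funpow_into[OF x(1)]] by (intro sum_nonneg mult_nonneg_nonneg) auto
    have "norm (measure_pmf.expectation (p j) (\<lambda>x. 1 - u x)) \<le> 1 / W j" for j
      using defect[of j] nonneg[of j] W_pos[of j] by (simp add: p divide_right_mono)
    then have "(\<lambda>n. measure_pmf.expectation (p (r n)) (\<lambda>x. 1 - u x)) \<longlonglongrightarrow> 0"
      by (intro Lim_null_comparison[OF _ W_lim'[of 1]]) auto
    then have "integral\<^sup>L \<mu> (\<lambda>x. 1 - u x) = 0" using LIMSEQ_unique conv[OF u1] by blast
    then have "AE x in \<mu>. 1 - u x = 0"
      using u(2) sp by (subst (asm) integral_nonneg_eq_0_iff_AE) (auto intro!: int u1)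
    then have "AE x in \<mu>. ln (u x) = 0" by eventually_elim simp
    then show ?thesis by (rule integral_eq_zero_AE)
  qed
  moreover have "integral\<^sup>L \<mu> (\<lambda>x. ln (f x)) = 0"
  proof (rule ln0[OF continuous_f f_range])
    show "(\<Sum>k<s j. w j k * (1 - f ((T ^^ k) (x j)))) \<le> 1" for j
      unfolding w_def using orbit_f_range[OF x(1)] orbit_g_range[OF x(1)]
      by (rule triangular_weight_defect_left)
  qed
  moreover have "integral\<^sup>L \<mu> (\<lambda>x. ln (g x)) = 0"
  proof (rule ln0[OF continuous_g g_range])
    show "(\<Sum>k<s j. w j k * (1 - g ((T ^^ k) (x j)))) \<le> 1" for j
      unfolding w_def using orbit_f_range[OF x(1)] orbit_g_range[OF x(1)]
      by (rule triangular_weight_defect_right)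
  qed
  moreover have "c \<le> \<bar>integral\<^sup>L \<mu> \<phi>\<bar>"
  proof (rule tendsto_lowerbound)
    show "(\<lambda>n. \<bar>measure_pmf.expectation (p (r n)) \<phi>\<bar>) \<longlonglongrightarrow> \<bar>integral\<^sup>L \<mu> \<phi>\<bar>"
      by (intro tendsto_rabs conv continuous_\<phi>)
    \<comment> \<open>Normalisation divides the corner by \<open>W j\<close>, which is at most
      \<open>s j\<close>, so the ratio \<open>c\<close> can only grow.\<close>
    have "c \<le> \<bar>measure_pmf.expectation (p j) \<phi>\<bar>" for j
    proof -
      have "W j * c \<le> real (s j) * c" using W_le \<open>0 < c\<close> by simp
      also have "\<dots> \<le> \<bar>corner (s j) (x j)\<bar>" by (rule x)
      finally show ?thesis
        using W_pos[of j] by (simp add: p flip: w_def corner_def) (simp add: corner_def w_def field_simps)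
    qed
    then show "eventually (\<lambda>n. c \<le> \<bar>measure_pmf.expectation (p (r n)) \<phi>\<bar>) sequentially" by simp
  qed simp
  ultimately show ?thesis by (intro that)
qed

text \<open>The assumptions characterise \<open>L\<close> as the least nonnegative bound for the
  modulus of the integral of \<open>\<phi>\<close> over \<open>Z\<close>. This form treats both
  cases together: a supremum if \<open>Z\<close> is nonempty, and 0 if it is empty.\<close>

lemma limit_of_growth:
  fixes L :: real
  defines "R \<equiv> \<lambda>n. (1 / real n) * (SUP x\<in>X. mnorm (cocycle (\<lambda>x. uptri (f x) (\<phi> x) (g x)) T n x))"
  defines "Z \<equiv> {\<mu> \<in> invariant_measures X T. integral\<^sup>L \<mu> (\<lambda>x. ln (f x)) = 0 \<and> integral\<^sup>L \<mu> (\<lambda>x. ln (g x)) = 0}"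
  assumes "0 \<le> L" and upper: "\<And>\<mu>. \<mu> \<in> Z \<Longrightarrow> \<bar>integral\<^sup>L \<mu> \<phi>\<bar> \<le> L"
    and lower: "\<And>M. 0 \<le> M \<Longrightarrow> (\<And>\<mu>. \<mu> \<in> Z \<Longrightarrow> \<bar>integral\<^sup>L \<mu> \<phi>\<bar> \<le> M) \<Longrightarrow> L \<le> M"
  shows "R \<longlonglongrightarrow> L"
proof -
  let ?N = "\<lambda>n x. mnorm (cocycle (\<lambda>x. uptri (f x) (\<phi> x) (g x)) T n x)"
  have corner_le: "\<bar>corner n x\<bar> \<le> (SUP x\<in>X. ?N n x)" if "x \<in> X" for n x
    by (rule order_trans[OF mnorm_cocycle_bounds(1)[OF that] cSUP_upper[OF that bdd_above_mnorm_cocycle]])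
  \<comment> \<open>\<open>R n\<close> is itself such a bound, so the inequality holds for each
    positive \<open>n\<close> and not merely in the limit.\<close>
  have ge: "L \<le> R n" if "n > 0" for n
  proof (rule lower)
    obtain x where "x \<in> X" using nonempty_X by blast
    then have "0 \<le> (SUP x\<in>X. ?N n x)" using corner_le[of x n] by linarith
    then show "0 \<le> R n" by (simp add: R_def)
    fix \<mu> assume "\<mu> \<in> Z"
    then have "real n * \<bar>integral\<^sup>L \<mu> \<phi>\<bar> \<le> (SUP x\<in>X. ?N n x)"
      by (intro integral_le_corner_bound corner_le) (auto simp: Z_def)
    then show "\<bar>integral\<^sup>L \<mu> \<phi>\<bar> \<le> R n" using that by (simp add: R_def field_simps)
  qed
  show ?thesis
  proof (rule order_tendstoI)
    fix y assume "y < L"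
    then show "eventually (\<lambda>n. y < R n) sequentially"
      by (intro eventually_mono[OF eventually_gt_at_top[of 0]]) (rule less_le_trans[OF _ ge])
  next
    fix y assume "L < y"
    \<comment> \<open>The midpoint leaves room on both sides: \<open>L < c\<close> rules out large
      corners infinitely often, and the gap \<open>y - c\<close> absorbs the 2 from the diagonal
      once \<open>n\<close> exceeds \<open>2 / (y - c)\<close>.\<close>
    define c where "c = (L + y) / 2"
    have c: "L < c" "c < y" "0 < c" using \<open>L < y\<close> \<open>0 \<le> L\<close> by (auto simp: c_def)
    have "\<not> (\<exists>\<^sub>\<infinity>n. \<exists>x\<in>X. real n * c \<le> \<bar>corner n x\<bar>)"
    proof
      assume "\<exists>\<^sub>\<infinity>n. \<exists>x\<in>X. real n * c \<le> \<bar>corner n x\<bar>"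
      from exists_measure_of_large_corners[OF c(3) this] obtain \<mu> where "\<mu> \<in> Z" "c \<le> \<bar>integral\<^sup>L \<mu> \<phi>\<bar>"
        unfolding Z_def by blast
      then show False using upper[of \<mu>] c(1) by linarith
    qed
    then have "eventually (\<lambda>n. \<forall>x\<in>X. \<bar>corner n x\<bar> < real n * c) sequentially"
      by (simp add: frequently_def cofinite_eq_sequentially not_le)
    moreover have "eventually (\<lambda>n. 2 / (y - c) < real n) sequentially"
      using filterlim_real_sequentially unfolding filterlim_at_top_dense by blast
    ultimately show "eventually (\<lambda>n. R n < y) sequentially"
      using eventually_gt_at_top[of 0]
    proof eventually_elim
      case (elim n)
      have "(SUP x\<in>X. ?N n x) \<le> real n * c + 2"
      proof (rule cSUP_least[OF nonempty_X])
        fix x assume "x \<in> X"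
        then show "?N n x \<le> real n * c + 2" using elim(1) mnorm_cocycle_bounds(2)[of x n] by force
      qed
      also have "\<dots> < real n * y" using elim(2) c(2) by (simp add: field_simps)
      finally show ?case using elim(3) by (simp add: R_def field_simps)
    qed
  qed
qed

end

theorem theorem3p1:
  fixes X :: "'a::metric_space set" and T :: "'a \<Rightarrow> 'a"
    and f g \<phi> :: "'a \<Rightarrow> real"
  assumes "compact X" and "X \<noteq> {}"
    and "\<exists>T'. homeomorphism X X T T'"
    and "continuous_on X f" and "continuous_on X g" and "continuous_on X \<phi>"
    and "\<forall>x\<in>X. 0 < f x \<and> f x \<le> 1"
    and "\<forall>x\<in>X. 0 < g x \<and> g x \<le> 1"
    and "beta X T (\<lambda>x. ln (f x)) = 0" and "beta X T (\<lambda>x. ln (g x)) = 0"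
  shows "(max_measures X T (\<lambda>x. ln (f x)) \<inter> max_measures X T (\<lambda>x. ln (g x)) \<noteq> {} \<longrightarrow>
           (\<lambda>n. (1 / real n) * (SUP x\<in>X. mnorm (cocycle (\<lambda>x. uptri (f x) (\<phi> x) (g x)) T n x)))
             \<longlonglongrightarrow> (SUP \<mu>\<in>max_measures X T (\<lambda>x. ln (f x)) \<inter> max_measures X T (\<lambda>x. ln (g x)).
                    \<bar>integral\<^sup>L \<mu> \<phi>\<bar>))
       \<and> (max_measures X T (\<lambda>x. ln (f x)) \<inter> max_measures X T (\<lambda>x. ln (g x)) = {} \<longrightarrow>
           (\<lambda>n. (1 / real n) * (SUP x\<in>X. mnorm (cocycle (\<lambda>x. uptri (f x) (\<phi> x) (g x)) T n x)))
             \<longlonglongrightarrow> 0)"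
proof -
  interpret triangular_cocycle X T f g \<phi>
    using assms(1-8) by unfold_locales (auto simp: homeomorphism_def)
  define Z where "Z = {\<mu> \<in> invariant_measures X T.
    integral\<^sup>L \<mu> (\<lambda>x. ln (f x)) = 0 \<and> integral\<^sup>L \<mu> (\<lambda>x. ln (g x)) = 0}"
  have Z: "max_measures X T (\<lambda>x. ln (f x)) \<inter> max_measures X T (\<lambda>x. ln (g x)) = Z"
    using assms(9,10) by (auto simp: max_measures_def Z_def)
  \<comment> \<open>A bound on \<open>\<phi>\<close> bounds the integrals over \<open>Z\<close>, so
    that their real supremum is a genuine least upper bound.\<close>
  obtain B where B: "\<And>x. x \<in> X \<Longrightarrow> \<bar>\<phi> x\<bar> \<le> B"
    using compact_continuous_abs_bound[OF assms(1,6)] by metis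
  have "\<bar>integral\<^sup>L \<mu> \<phi>\<bar> \<le> B" if "\<mu> \<in> Z" for \<mu>
  proof -
    have "\<mu> \<in> invariant_measures X T" using that by (simp add: Z_def)
    note D = invariant_measuresD[OF this]
    have "\<bar>integral\<^sup>L \<mu> \<phi>\<bar> \<le> integral\<^sup>L \<mu> (\<lambda>x. \<bar>\<phi> x\<bar>)" by (rule integral_abs_bound)
    also have "\<dots> \<le> B"
      using integrable_continuous_on_compact[OF D(1,2) assms(1,6)] B D(3)
      by (intro prob_space.integral_le_const[OF D(1)] AE_I2) auto
    finally show ?thesis .
  qed
  then have bdd: "bdd_above ((\<lambda>\<mu>. \<bar>integral\<^sup>L \<mu> \<phi>\<bar>) ` Z)" by (auto intro!: bdd_aboveI)
  let ?R = "\<lambda>n. (1 / real n) * (SUP x\<in>X. mnorm (cocycle (\<lambda>x. uptri (f x) (\<phi> x) (g x)) T n x))"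
  have "?R \<longlonglongrightarrow> (SUP \<mu>\<in>Z. \<bar>integral\<^sup>L \<mu> \<phi>\<bar>)" if nonempty: "Z \<noteq> {}"
  proof (rule limit_of_growth, fold Z_def)
    show upper: "\<bar>integral\<^sup>L \<mu> \<phi>\<bar> \<le> (SUP \<mu>\<in>Z. \<bar>integral\<^sup>L \<mu> \<phi>\<bar>)" if "\<mu> \<in> Z" for \<mu>
      by (rule cSUP_upper[OF that bdd])
    obtain \<mu> where "\<mu> \<in> Z" using nonempty by blast
    then show "0 \<le> (SUP \<mu>\<in>Z. \<bar>integral\<^sup>L \<mu> \<phi>\<bar>)" using upper[of \<mu>] by linarith
  qed (use nonempty in \<open>auto intro!: cSUP_least\<close>)
  moreover have "?R \<longlonglongrightarrow> 0" if "Z = {}"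
    by (rule limit_of_growth, fold Z_def) (use that in auto)
  ultimately show ?thesis unfolding Z by blast
qed

end
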